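(* Let $(\Omega,\mathcal H,\hat{\mathbb E})$ be a sublinear expectation space, let $0<\underline\sigma^2<\overline\sigma^2$, let $n\ge 2$, and let $Y=(Y_1,\dots,Y_n)\in\mathcal H^n$ be such that $Y_1\sim\mathcal N(0,[\underline\sigma^2,\overline\sigma^2])$ and, for each $1\le i\le n-1$, $Y_{i+1}\sim Y_i$ and $Y_{i+1}$ is independent from $(Y_1,\dots,Y_i)$. Let $a_1=1$, $a_2=1$, $b_1=1$, $b_2=-1$ and $a_i=b_i=0$ for $i>2$, i.e. $$U=\sum_{i=1}^n a_iY_i=Y_1+Y_2,\qquad V=\sum_{i=1}^n b_iY_i=Y_1-Y_2 .$$ Then $\sum_{i=1}^n a_ib_i=0$, but $U$ is not independent from $V$ and $V$ is not independent from $U$.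
   Context: $C_{l.Lip}(\mathbb R^n)$ is the set of functions $\varphi:\mathbb R^n\to\mathbb R$ for which there exist $C>0$ and $m\in\mathbb N$ with $|\varphi(x)-\varphi(y)|\le C(1+|x|^m+|y|^m)|x-y|$ for all $x,y\in\mathbb R^n$. Let $\Omega$ be a set and $\mathcal H$ a linear space of real-valued functions on $\Omega$ which contains all constants and contains $\varphi(X_1,\dots,X_n)$ whenever $X_1,\dots,X_n\in\mathcal H$ and $\varphi\in C_{l.Lip}(\mathbb R^n)$. A sublinear expectation is a map $\hat{\mathbb E}:\mathcal H\to\mathbb R$ such that: $\hat{\mathbb E}[X]\le\hat{\mathbb E}[Y]$ if $X\le Y$; $\hat{\mathbb E}[c]=c$ for $c\in\mathbb R$; $\hat{\mathbb E}[X+Y]\le\hat{\mathbb E}[X]+\hat{\mathbb E}[Y]$; $\hat{\mathbb E}[\lambda X]=\lambda\hat{\mathbb E}[X]$ for $\lambda\ge0$. Then $(\Omega,\mathcal H,\hat{\mathbb E})$ is a sublinear expectation space. Elements of $\mathcal H$ are random variables; elements of $\mathcal H^n$ are $n$-dimensional random vectors. Independence (possibly asymmetric): $Y\in\mathcal H^n$ is independent from $X\in\mathcal H^m$ if $\hat{\mathbb E}[\varphi(X,Y)]=\hat{\mathbb E}\big[\hat{\mathbb E}[\varphi(x,Y)]_{x=X}\big]$ for all $\varphi\in C_{l.Lip}(\mathbb R^{m+n})$. Identical distribution: $X,Y\in\mathcal H^n$ satisfy $X\sim Y$ if $\hat{\mathbb E}[\varphi(X)]=\hat{\mathbb E}[\varphi(Y)]$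 for all $\varphi\in C_{l.Lip}(\mathbb R^n)$. If $X\sim\bar X$ and $\bar X$ is independent from $X$, then $\bar X$ is an independent copy of $X$. $G$-normality: $X\in\mathcal H^n$ is $G$-normally distributed if $aX+b\bar X\sim\sqrt{a^2+b^2}\,X$ for all $a,b\ge0$ and any independent copy $\bar X$ of $X$. As usual the independent copy may live on an enlarged (product) sublinear expectation space, so the condition is never vacuous; it means exactly that $\hat{\mathbb E}\big[\hat{\mathbb E}[\varphi(ax+bX)]_{x=X}\big]=\hat{\mathbb E}[\varphi(\sqrt{a^2+b^2}\,X)]$ for all $a,b\ge0$ and $\varphi\in C_{l.Lip}(\mathbb R^n)$. For a random variable $X$ and $0\le\underline\sigma^2\le\overline\sigma^2$, $X\sim\mathcal N(0,[\underline\sigma^2,\overline\sigma^2])$ means that $X$ is $G$-normally distributed with $\hat{\mathbb E}[X^2]=\overline\sigma^2$ and $-\hat{\mathbb E}[-X^2]=\underline\sigma^2$. *)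

theory Defs
  imports "HOL-Analysis.Analysis"
begin

text \<open>
  Dimensions vary inside the definitions below, so a point of the Euclidean space of dimension
  \<open>n\<close> is a list of reals of length \<open>n\<close>, an \<open>n\<close>-dimensional random vector is a list of \<open>n\<close> random
  variables, and the pair \<open>(X, Y)\<close> of two vectors is the concatenation \<open>X @ Y\<close>.
  Functions on \<open>n\<close>-dimensional space are functions on lists of which only the values at lists of
  length \<open>n\<close> matter.
\<close>

definition vec_norm :: "real list \<Rightarrow> real" where
  "vec_norm x = L2_set (\<lambda>i. x ! i) {..<length x}"

definition C_l_Lip :: "nat \<Rightarrow> (real list \<Rightarrow> real) set" where
  "C_l_Lip n = {\<phi>. \<exists>C>0. \<exists>m::nat. \<forall>x y. length x = n \<longrightarrow> length y = n \<longrightarrow>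
     \<bar>\<phi> x - \<phi> y\<bar> \<le> C * (1 + vec_norm x ^ m + vec_norm y ^ m) * vec_norm (map2 (-) x y)}"

text \<open>
  The sample space is the whole type \<open>'w\<close>. The functional \<open>E\<close> is only constrained on \<open>H\<close>.
\<close>

locale sublinear_expectation_space =
  fixes H :: "('w \<Rightarrow> real) set" and E :: "('w \<Rightarrow> real) \<Rightarrow> real"
  assumes const_mem: "(\<lambda>\<omega>. c) \<in> H"
    and add_mem: "X \<in> H \<Longrightarrow> Y \<in> H \<Longrightarrow> (\<lambda>\<omega>. X \<omega> + Y \<omega>) \<in> H"
    and scale_mem: "X \<in> H \<Longrightarrow> (\<lambda>\<omega>. c * X \<omega>) \<in> H"
    and C_l_Lip_mem: "set Xs \<subseteq> H \<Longrightarrow> \<phi> \<in> C_l_Lip (length Xs) \<Longrightarrow>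
      (\<lambda>\<omega>. \<phi> (map (\<lambda>X. X \<omega>) Xs)) \<in> H"
    and E_mono: "X \<in> H \<Longrightarrow> Y \<in> H \<Longrightarrow> (\<And>\<omega>. X \<omega> \<le> Y \<omega>) \<Longrightarrow> E X \<le> E Y"
    and E_const: "E (\<lambda>\<omega>. c) = c"
    and E_subadd: "X \<in> H \<Longrightarrow> Y \<in> H \<Longrightarrow> E (\<lambda>\<omega>. X \<omega> + Y \<omega>) \<le> E X + E Y"
    and E_pos_hom: "X \<in> H \<Longrightarrow> 0 \<le> c \<Longrightarrow> E (\<lambda>\<omega>. c * X \<omega>) = c * E X"

text \<open>
  The next notions are meant for vectors \<open>Xs\<close>, \<open>Ys\<close> with entries in \<open>H\<close>. Independence is not
  symmetric: \<open>indep_from E Ys Xs\<close> says that \<open>Ys\<close> is independent from \<open>Xs\<close>.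
\<close>

definition indep_from ::
    "(('w \<Rightarrow> real) \<Rightarrow> real) \<Rightarrow> ('w \<Rightarrow> real) list \<Rightarrow> ('w \<Rightarrow> real) list \<Rightarrow> bool" where
  "indep_from E Ys Xs \<longleftrightarrow> (\<forall>\<phi> \<in> C_l_Lip (length Xs + length Ys).
     E (\<lambda>\<omega>. \<phi> (map (\<lambda>X. X \<omega>) Xs @ map (\<lambda>Y. Y \<omega>) Ys)) =
     E (\<lambda>\<omega>. E (\<lambda>\<omega>'. \<phi> (map (\<lambda>X. X \<omega>) Xs @ map (\<lambda>Y. Y \<omega>') Ys))))"

definition ident_dist ::
    "(('w \<Rightarrow> real) \<Rightarrow> real) \<Rightarrow> ('w \<Rightarrow> real) list \<Rightarrow> ('w \<Rightarrow> real) list \<Rightarrow> bool" where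
  "ident_dist E Xs Ys \<longleftrightarrow> length Xs = length Ys \<and> (\<forall>\<phi> \<in> C_l_Lip (length Xs).
     E (\<lambda>\<omega>. \<phi> (map (\<lambda>X. X \<omega>) Xs)) = E (\<lambda>\<omega>. \<phi> (map (\<lambda>Y. Y \<omega>) Ys)))"

text \<open>
  \<open>G\<close>-normality of \<open>X\<close> asks that \<open>a X + b X'\<close> and \<open>sqrt (a\<^sup>2 + b\<^sup>2) X\<close> are identically distributed for
  an independent copy \<open>X'\<close> of \<open>X\<close>, which may live on an enlarged space. The iterated expectation
  below is the expectation of \<open>\<phi> (a X + b X')\<close> computed on the product space, so that the
  condition is not vacuous when the given space carries no independent copy.
\<close>

definition G_normal :: "(('w \<Rightarrow> real) \<Rightarrow> real) \<Rightarrow> ('w \<Rightarrow> real) list \<Rightarrow> bool" where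
  "G_normal E Xs \<longleftrightarrow> (\<forall>a\<ge>0. \<forall>b\<ge>0. \<forall>\<phi> \<in> C_l_Lip (length Xs).
     E (\<lambda>\<omega>. E (\<lambda>\<omega>'. \<phi> (map (\<lambda>X. a * X \<omega> + b * X \<omega>') Xs))) =
     E (\<lambda>\<omega>. \<phi> (map (\<lambda>X. sqrt (a\<^sup>2 + b\<^sup>2) * X \<omega>) Xs)))"

text \<open>The parameters \<open>v\<close> and \<open>w\<close> are the lower and the upper variance.\<close>

definition normal_dist ::
    "(('w \<Rightarrow> real) \<Rightarrow> real) \<Rightarrow> ('w \<Rightarrow> real) \<Rightarrow> real \<Rightarrow> real \<Rightarrow> bool" where
  "normal_dist E X v w \<longleftrightarrow> G_normal E [X] \<and>
     E (\<lambda>\<omega>. (X \<omega>)\<^sup>2) = w \<and> - E (\<lambda>\<omega>. - (X \<omega>)\<^sup>2) = v"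

end

theory Submission imports Defs begin

text \<open>
  The joint law of \<open>U = X + Y\<close> and \<open>V = X - Y\<close>, where \<open>Y\<close> is independent from \<open>X\<close> and both follow
  \<open>N(0, [v, w])\<close>, betrays the dependence at the third order. If \<open>U\<close> were independent from \<open>V\<close>, then
  \<open>E[V\<^sup>2 U] = E[V\<^sup>2 E[U]] = 0\<close>, because \<open>G\<close>-normal variables have mean zero; symmetrically
  \<open>E[U\<^sup>2 V] = 0\<close> if \<open>V\<close> were independent from \<open>U\<close>. Both expectations are in fact strictly positive.
  Both products have the form \<open>(X\<^sup>2 - Y\<^sup>2) (X - q Y)\<close>, with \<open>q = 1\<close> and \<open>q = -1\<close>. Given
  \<open>X = x\<close>, the mean of \<open>Y\<close> contributes nothing, and what remains is \<open>x\<^sup>3 + E[- x Y\<^sup>2 + q Y\<^sup>3]\<close>.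
  The sublinear expectation is a supremum over models, and in these the variance of \<open>Y\<close> may be
  chosen according to the sign of \<open>x\<close>: small if \<open>x > 0\<close>, large if \<open>x < 0\<close>. This leaves a gain
  proportional to \<open>\<bar>x\<bar>\<close>.

  To make this precise, one needs for every \<open>t\<close> between \<open>v\<close> and \<open>w\<close> the lower bound
  \<open>E[p X\<^sup>2 + q X\<^sup>3] \<ge> p t\<close> (\<open>mixed_moment_ge\<close>): among the linear expectations dominated by \<open>E\<close>
  there is one with variance \<open>t\<close> and third moment zero, namely the classical normal law. It is not
  constructed here. Instead the stability property of \<open>G\<close>-normality under
  \<open>(X + X') / sqrt 2\<close> is iterated, as in the central limit theorem; each step keeps the
  variance and divides the third moment by \<open>sqrt 2\<close>.

  With \<open>t = v\<close> for \<open>x \<ge> 0\<close> and \<open>t = w\<close> for \<open>x < 0\<close> the bound gives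
  \<open>E[- x Y\<^sup>2 + q Y\<^sup>3] \<ge> - m x + d \<bar>x\<bar>\<close>, where \<open>m = (v + w) / 2\<close> and \<open>d = (w - v) / 2 > 0\<close>.
  It remains to see that \<open>E[X\<^sup>3 + d \<bar>X\<bar>] > 0\<close> (\<open>E_cube_plus_abs_pos\<close>). This follows
  from the same bound after replacing \<open>\<bar>X\<bar>\<close> by the minorant \<open>r X\<^sup>2 - r\<^sup>3 X\<^sup>4\<close>
  with \<open>r\<close> small, since the fourth moment is finite.
\<close>

section \<open>Locally Lipschitz functions form an algebra\<close>

lemma vec_norm_nonneg [simp]: "0 \<le> vec_norm x"
  by (simp add: vec_norm_def L2_set_nonneg)

lemma abs_nth_le_vec_norm: "i < length x \<Longrightarrow> \<bar>x ! i\<bar> \<le> vec_norm x"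
proof -
  assume "i < length x"
  then have "\<bar>x ! i\<bar> \<le> L2_set (\<lambda>i. \<bar>x ! i\<bar>) {..<length x}"
    by (intro member_le_L2_set) auto
  then show ?thesis by (simp add: vec_norm_def L2_set_def)
qed

lemma vec_norm_replicate_0 [simp]: "vec_norm (replicate n 0) = 0"
  by (simp add: vec_norm_def L2_set_def)

lemma map2_minus_replicate_0: "length x = n \<Longrightarrow> map2 (-) x (replicate n (0::real)) = x"
  by (rule nth_equalityI) auto

lemma sum_powers_le: "0 \<le> a \<Longrightarrow> 0 \<le> b \<Longrightarrow> 1 + a ^ m + b ^ m \<le> 3 * (1 + a + b :: real) ^ m"
proof -
  assume "0 \<le> a" "0 \<le> b"
  then have "1 ^ m \<le> (1 + a + b) ^ m" "a ^ m \<le> (1 + a + b) ^ m" "b ^ m \<le> (1 + a + b) ^ m"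
    by (auto intro!: power_mono)
  then show ?thesis by simp
qed

lemma power_sum_le:
  assumes "0 \<le> a" "0 \<le> (b::real)"
  shows "(1 + a + b) ^ m \<le> 3 ^ m * (1 + a ^ m + b ^ m)"
proof -
  define c where "c = max 1 (max a b)"
  have "(1 + a + b) ^ m \<le> (3 * c) ^ m"
    using assms by (intro power_mono) (auto simp: c_def)
  also have "\<dots> = 3 ^ m * c ^ m" by (rule power_mult_distrib)
  also have "c ^ m \<le> 1 + a ^ m + b ^ m"
  proof -
    have "c = 1 \<or> c = a \<or> c = b" by (auto simp: c_def max_def)
    then show ?thesis using assms zero_le_power[of a m] zero_le_power[of b m] by auto
  qed
  finally show ?thesis by simp
qed

text \<open>The weight \<open>(1 + |x| + |y|) ^ m\<close> is equivalent to \<open>1 + |x| ^ m + |y| ^ m\<close>, but it is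
  increasing in \<open>m\<close> and multiplicative, which is what closure under sums and products needs.\<close>

lemma C_l_Lip_iff:
  "f \<in> C_l_Lip n \<longleftrightarrow> (\<exists>C\<ge>0. \<exists>m::nat. \<forall>x y. length x = n \<longrightarrow> length y = n \<longrightarrow>
     \<bar>f x - f y\<bar> \<le> C * (1 + vec_norm x + vec_norm y) ^ m * vec_norm (map2 (-) x y))"
proof
  assume "f \<in> C_l_Lip n"
  then obtain C m where C: "C > 0" and *: "\<And>x y. length x = n \<Longrightarrow> length y = n \<Longrightarrow>
     \<bar>f x - f y\<bar> \<le> C * (1 + vec_norm x ^ m + vec_norm y ^ m) * vec_norm (map2 (-) x y)"
    unfolding C_l_Lip_def by blast
  show "\<exists>C\<ge>0. \<exists>m::nat. \<forall>x y. length x = n \<longrightarrow> length y = n \<longrightarrow>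
     \<bar>f x - f y\<bar> \<le> C * (1 + vec_norm x + vec_norm y) ^ m * vec_norm (map2 (-) x y)"
  proof (intro exI[of _ "3 * C"] exI[of _ m] conjI allI impI)
    fix x y :: "real list" assume "length x = n" "length y = n"
    then have "\<bar>f x - f y\<bar> \<le> C * (1 + vec_norm x ^ m + vec_norm y ^ m) * vec_norm (map2 (-) x y)"
      by (rule *)
    also have "\<dots> \<le> C * (3 * (1 + vec_norm x + vec_norm y) ^ m) * vec_norm (map2 (-) x y)"
      using C by (intro mult_right_mono mult_left_mono sum_powers_le) auto
    finally show "\<bar>f x - f y\<bar> \<le> 3 * C * (1 + vec_norm x + vec_norm y) ^ m * vec_norm (map2 (-) x y)"
      by (simp add: mult_ac)
  qed (use C in auto)
next
  assume "\<exists>C\<ge>0. \<exists>m::nat. \<forall>x y. length x = n \<longrightarrow> length y = n \<longrightarrow>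
     \<bar>f x - f y\<bar> \<le> C * (1 + vec_norm x + vec_norm y) ^ m * vec_norm (map2 (-) x y)"
  then obtain C m where C: "C \<ge> 0" and *: "\<And>x y. length x = n \<Longrightarrow> length y = n \<Longrightarrow>
     \<bar>f x - f y\<bar> \<le> C * (1 + vec_norm x + vec_norm y) ^ m * vec_norm (map2 (-) x y)"
    by blast
  show "f \<in> C_l_Lip n"
    unfolding C_l_Lip_def
  proof (intro CollectI exI[of _ "C * 3 ^ m + 1"] exI[of _ m] conjI allI impI)
    fix x y :: "real list" assume "length x = n" "length y = n"
    then have "\<bar>f x - f y\<bar> \<le> C * (1 + vec_norm x + vec_norm y) ^ m * vec_norm (map2 (-) x y)"
      by (rule *)
    also have "\<dots> \<le> C * (3 ^ m * (1 + vec_norm x ^ m + vec_norm y ^ m)) * vec_norm (map2 (-) x y)"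
      using C by (intro mult_right_mono mult_left_mono power_sum_le) auto
    also have "\<dots> = (C * 3 ^ m) * (1 + vec_norm x ^ m + vec_norm y ^ m) * vec_norm (map2 (-) x y)"
      by (simp add: mult_ac)
    also have "\<dots> \<le> (C * 3 ^ m + 1) * (1 + vec_norm x ^ m + vec_norm y ^ m) * vec_norm (map2 (-) x y)"
      by (intro mult_right_mono) (auto intro!: add_nonneg_nonneg)
    finally show "\<bar>f x - f y\<bar> \<le> (C * 3 ^ m + 1) * (1 + vec_norm x ^ m + vec_norm y ^ m) *
      vec_norm (map2 (-) x y)" .
  qed (use C in \<open>auto intro!: add_nonneg_pos\<close>)
qed

text \<open>Compare with the value at the origin.\<close>

lemma C_l_Lip_polynomial_growth:
  assumes "f \<in> C_l_Lip n"
  obtains D k where "D \<ge> 0" "\<And>x. length x = n \<Longrightarrow> \<bar>f x\<bar> \<le> D * (1 + vec_norm x) ^ k"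
proof -
  obtain C m where C: "C \<ge> 0" and *: "\<And>x y. length x = n \<Longrightarrow> length y = n \<Longrightarrow>
     \<bar>f x - f y\<bar> \<le> C * (1 + vec_norm x + vec_norm y) ^ m * vec_norm (map2 (-) x y)"
    using assms unfolding C_l_Lip_iff by blast
  show thesis
  proof (rule that[of "C + \<bar>f (replicate n 0)\<bar>" "Suc m"])
    fix x :: "real list" assume len: "length x = n"
    let ?z = "replicate n (0::real)"
    have "\<bar>f x\<bar> \<le> \<bar>f x - f ?z\<bar> + \<bar>f ?z\<bar>" by linarith
    also have "\<bar>f x - f ?z\<bar> \<le> C * (1 + vec_norm x) ^ m * vec_norm x"
      using *[OF len, of ?z] by (simp add: map2_minus_replicate_0[OF len])
    also have "\<dots> \<le> C * (1 + vec_norm x) ^ m * (1 + vec_norm x)"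
      using C by (intro mult_left_mono) auto
    also have "\<bar>f ?z\<bar> \<le> \<bar>f ?z\<bar> * (1 + vec_norm x) ^ Suc m"
      using one_le_power[of "1 + vec_norm x" "Suc m"] by (simp add: mult_le_cancel_left1 del: power_Suc)
    finally show "\<bar>f x\<bar> \<le> (C + \<bar>f ?z\<bar>) * (1 + vec_norm x) ^ Suc m"
      by (simp add: algebra_simps)
  qed (use C in auto)
qed

lemma C_l_Lip_const: "(\<lambda>x. c) \<in> C_l_Lip n"
  unfolding C_l_Lip_iff by (auto intro!: exI[of _ 0])

lemma C_l_Lip_nth:
  assumes "i < n"
  shows "(\<lambda>x. x ! i) \<in> C_l_Lip n"
  unfolding C_l_Lip_iff
proof (intro exI[of _ "1::real"] exI[of _ "0::nat"] conjI allI impI)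
  fix x y :: "real list" assume "length x = n" "length y = n"
  with assms show "\<bar>x ! i - y ! i\<bar> \<le> 1 * (1 + vec_norm x + vec_norm y) ^ 0 * vec_norm (map2 (-) x y)"
    using abs_nth_le_vec_norm[of i "map2 (-) x y"] by simp
qed auto

lemma C_l_Lip_add:
  assumes "f \<in> C_l_Lip n" "g \<in> C_l_Lip n"
  shows "(\<lambda>x. f x + g x) \<in> C_l_Lip n"
proof -
  obtain C m where C: "C \<ge> 0" and f: "\<And>x y. length x = n \<Longrightarrow> length y = n \<Longrightarrow>
     \<bar>f x - f y\<bar> \<le> C * (1 + vec_norm x + vec_norm y) ^ m * vec_norm (map2 (-) x y)"
    using assms unfolding C_l_Lip_iff by blast
  obtain D k where D: "D \<ge> 0" and g: "\<And>x y. length x = n \<Longrightarrow> length y = n \<Longrightarrow>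
     \<bar>g x - g y\<bar> \<le> D * (1 + vec_norm x + vec_norm y) ^ k * vec_norm (map2 (-) x y)"
    using assms unfolding C_l_Lip_iff by blast
  show ?thesis unfolding C_l_Lip_iff
  proof (intro exI[of _ "C + D"] exI[of _ "m + k"] conjI allI impI)
    fix x y :: "real list" assume len: "length x = n" "length y = n"
    let ?w = "1 + vec_norm x + vec_norm y" and ?d = "vec_norm (map2 (-) x y)"
    have "\<bar>f x + g x - (f y + g y)\<bar> \<le> \<bar>f x - f y\<bar> + \<bar>g x - g y\<bar>" by linarith
    also have "\<dots> \<le> C * ?w ^ m * ?d + D * ?w ^ k * ?d"
      using f[OF len] g[OF len] by linarith
    also have "\<dots> \<le> C * ?w ^ (m + k) * ?d + D * ?w ^ (m + k) * ?d"
      using C D by (intro add_mono mult_right_mono mult_left_mono power_increasing) auto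
    finally show "\<bar>f x + g x - (f y + g y)\<bar> \<le> (C + D) * ?w ^ (m + k) * ?d"
      by (simp add: algebra_simps)
  qed (use C D in auto)
qed

lemma C_l_Lip_mult:
  assumes "f \<in> C_l_Lip n" "g \<in> C_l_Lip n"
  shows "(\<lambda>x. f x * g x) \<in> C_l_Lip n"
proof -
  obtain C m where C: "C \<ge> 0" and f: "\<And>x y. length x = n \<Longrightarrow> length y = n \<Longrightarrow>
     \<bar>f x - f y\<bar> \<le> C * (1 + vec_norm x + vec_norm y) ^ m * vec_norm (map2 (-) x y)"
    using assms unfolding C_l_Lip_iff by blast
  obtain D k where D: "D \<ge> 0" and g: "\<And>x y. length x = n \<Longrightarrow> length y = n \<Longrightarrow>
     \<bar>g x - g y\<bar> \<le> D * (1 + vec_norm x + vec_norm y) ^ k * vec_norm (map2 (-) x y)"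
    using assms unfolding C_l_Lip_iff by blast
  obtain C' m' where C': "C' \<ge> 0" and f': "\<And>x. length x = n \<Longrightarrow> \<bar>f x\<bar> \<le> C' * (1 + vec_norm x) ^ m'"
    using C_l_Lip_polynomial_growth[OF assms(1)] by blast
  obtain D' k' where D': "D' \<ge> 0" and g': "\<And>x. length x = n \<Longrightarrow> \<bar>g x\<bar> \<le> D' * (1 + vec_norm x) ^ k'"
    using C_l_Lip_polynomial_growth[OF assms(2)] by blast
  let ?M = "m + k + m' + k'"
  show ?thesis unfolding C_l_Lip_iff
  proof (intro exI[of _ "C' * D + D' * C"] exI[of _ ?M] conjI allI impI)
    fix x y :: "real list" assume len: "length x = n" "length y = n"
    let ?w = "1 + vec_norm x + vec_norm y" and ?d = "vec_norm (map2 (-) x y)"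
    have fx: "\<bar>f x\<bar> \<le> C' * ?w ^ m'"
      using f'[OF len(1)] by (rule order_trans) (use C' in \<open>auto intro!: mult_left_mono power_mono\<close>)
    have gy: "\<bar>g y\<bar> \<le> D' * ?w ^ k'"
      using g'[OF len(2)] by (rule order_trans) (use D' in \<open>auto intro!: mult_left_mono power_mono\<close>)
    have "f x * g x - f y * g y = f x * (g x - g y) + g y * (f x - f y)"
      by (simp add: algebra_simps)
    then have "\<bar>f x * g x - f y * g y\<bar> \<le> \<bar>f x\<bar> * \<bar>g x - g y\<bar> + \<bar>g y\<bar> * \<bar>f x - f y\<bar>"
      by (metis abs_mult abs_triangle_ineq)
    also have "\<dots> \<le> (C' * ?w ^ m') * (D * ?w ^ k * ?d) + (D' * ?w ^ k') * (C * ?w ^ m * ?d)"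
      using fx gy f[OF len] g[OF len] C C' D D'
      by (intro add_mono mult_mono) (auto intro!: mult_nonneg_nonneg)
    also have "\<dots> = C' * D * ?w ^ (m' + k) * ?d + D' * C * ?w ^ (k' + m) * ?d"
      by (simp add: power_add mult_ac)
    also have "\<dots> \<le> C' * D * ?w ^ ?M * ?d + D' * C * ?w ^ ?M * ?d"
    proof -
      have "?w ^ (m' + k) \<le> ?w ^ ?M" "?w ^ (k' + m) \<le> ?w ^ ?M"
        by (auto intro!: power_increasing)
      then show ?thesis
        using C C' D D' by (intro add_mono mult_right_mono mult_left_mono) auto
    qed
    finally show "\<bar>f x * g x - f y * g y\<bar> \<le> (C' * D + D' * C) * ?w ^ ?M * ?d"
      by (simp add: algebra_simps)
  qed (use C C' D D' in auto)
qed

lemma C_l_Lip_power: "f \<in> C_l_Lip n \<Longrightarrow> (\<lambda>x. f x ^ k) \<in> C_l_Lip n"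
  by (induction k) (auto intro: C_l_Lip_const C_l_Lip_mult)

lemma C_l_Lip_diff:
  assumes "f \<in> C_l_Lip n" "g \<in> C_l_Lip n"
  shows "(\<lambda>x. f x - g x) \<in> C_l_Lip n"
  using C_l_Lip_add[OF assms(1) C_l_Lip_mult[OF C_l_Lip_const[of "-1"] assms(2)]] by simp

lemma C_l_Lip_Lipschitz_comp:
  assumes "\<And>s t. \<bar>g s - g t\<bar> \<le> L * \<bar>s - t\<bar>" and "f \<in> C_l_Lip n"
  shows "(\<lambda>x. g (f x)) \<in> C_l_Lip n"
proof -
  obtain C m where C: "C \<ge> 0" and f: "\<And>x y. length x = n \<Longrightarrow> length y = n \<Longrightarrow>
     \<bar>f x - f y\<bar> \<le> C * (1 + vec_norm x + vec_norm y) ^ m * vec_norm (map2 (-) x y)"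
    using assms(2) unfolding C_l_Lip_iff by blast
  have L: "L \<ge> 0" using assms(1)[of 1 0] by simp
  show ?thesis unfolding C_l_Lip_iff
  proof (intro exI[of _ "L * C"] exI[of _ m] conjI allI impI)
    fix x y :: "real list" assume len: "length x = n" "length y = n"
    have "\<bar>g (f x) - g (f y)\<bar> \<le> L * \<bar>f x - f y\<bar>" by (rule assms(1))
    also have "\<dots> \<le> L * (C * (1 + vec_norm x + vec_norm y) ^ m * vec_norm (map2 (-) x y))"
      using f[OF len] L by (rule mult_left_mono)
    finally show "\<bar>g (f x) - g (f y)\<bar> \<le>
        L * C * (1 + vec_norm x + vec_norm y) ^ m * vec_norm (map2 (-) x y)"
      by (simp add: mult_ac)
  qed (use C L in auto)
qed

lemmas C_l_Lip_intros =
  C_l_Lip_const C_l_Lip_nth C_l_Lip_add C_l_Lip_diff C_l_Lip_mult C_l_Lip_power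

section \<open>Sublinear expectations\<close>

context sublinear_expectation_space
begin

lemma mult_mem: "X \<in> H \<Longrightarrow> Y \<in> H \<Longrightarrow> (\<lambda>\<omega>. X \<omega> * Y \<omega>) \<in> H"
  using C_l_Lip_mem[of "[X, Y]" "\<lambda>x. x ! 0 * x ! 1"] by (simp add: C_l_Lip_intros)

lemma power_mem: "X \<in> H \<Longrightarrow> (\<lambda>\<omega>. X \<omega> ^ k) \<in> H"
  by (induction k) (auto intro: const_mem mult_mem)

lemma minus_mem: "X \<in> H \<Longrightarrow> (\<lambda>\<omega>. - X \<omega>) \<in> H"
  using scale_mem[of X "-1"] by simp

lemma diff_mem: "X \<in> H \<Longrightarrow> Y \<in> H \<Longrightarrow> (\<lambda>\<omega>. X \<omega> - Y \<omega>) \<in> H"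
  using add_mem[OF _ minus_mem] by simp

lemma Lipschitz_comp_mem:
  assumes "X \<in> H" "\<And>s t. \<bar>g s - g t\<bar> \<le> L * \<bar>s - t\<bar>"
  shows "(\<lambda>\<omega>. g (X \<omega>)) \<in> H"
  using C_l_Lip_mem[of "[X]" "\<lambda>x. g (x ! 0)"] assms C_l_Lip_Lipschitz_comp[OF assms(2) C_l_Lip_nth[of 0 1]]
  by simp

lemma abs_mem: "X \<in> H \<Longrightarrow> (\<lambda>\<omega>. \<bar>X \<omega>\<bar>) \<in> H"
  by (rule Lipschitz_comp_mem[where g = abs and L = 1]) auto

lemmas mem_intros = const_mem add_mem scale_mem mult_mem power_mem minus_mem diff_mem abs_mem

lemma E_add_const: "Z \<in> H \<Longrightarrow> E (\<lambda>\<omega>. c + Z \<omega>) = c + E Z"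
proof (rule antisym)
  assume Z: "Z \<in> H"
  show "E (\<lambda>\<omega>. c + Z \<omega>) \<le> c + E Z"
    using E_subadd[OF const_mem[of c] Z] by (simp add: E_const)
  show "c + E Z \<le> E (\<lambda>\<omega>. c + Z \<omega>)"
    using E_subadd[OF const_mem[of "-c"] add_mem[OF const_mem[of c] Z]] by (simp add: E_const)
qed

lemma E_diff_ge: "Z \<in> H \<Longrightarrow> W \<in> H \<Longrightarrow> E Z - E W \<le> E (\<lambda>\<omega>. Z \<omega> - W \<omega>)"
  using E_subadd[of "\<lambda>\<omega>. Z \<omega> - W \<omega>" W] by (simp add: diff_mem)

text \<open>Every multiple of \<open>X\<close>, of either sign, has expectation zero, so that subadditivity, used for
  \<open>Z\<close> and for \<open>(c X + Z) - c X\<close>, gives both inequalities.\<close>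

lemma E_add_scaled_centred:
  assumes "Z \<in> H" "X \<in> H" "E X = 0" "E (\<lambda>\<omega>. - X \<omega>) = 0"
  shows "E (\<lambda>\<omega>. c * X \<omega> + Z \<omega>) = E Z"
proof -
  have 0: "E (\<lambda>\<omega>. d * X \<omega>) = 0" for d
  proof (cases "d \<ge> 0")
    case True then show ?thesis using E_pos_hom[of X d] assms by simp
  next
    case False then show ?thesis
      using E_pos_hom[of "\<lambda>\<omega>. - X \<omega>" "-d"] assms by (simp add: minus_mem)
  qed
  show ?thesis
    using E_subadd[OF scale_mem[of X c] assms(1)]
      E_subadd[OF scale_mem[of X "-c"] add_mem[OF scale_mem[of X c] assms(1)]] assms(2)
      0[of c] 0[of "-c"]
    by simp
qed

section \<open>Second and third moments of a G-normal variable\<close>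

definition mixed_moment :: "('w \<Rightarrow> real) \<Rightarrow> real \<Rightarrow> real \<Rightarrow> real" where
  "mixed_moment X p q = E (\<lambda>\<omega>. p * (X \<omega>)\<^sup>2 + q * (X \<omega>) ^ 3)"

lemma mixed_moment_change_le:
  assumes "X \<in> H"
  shows "mixed_moment X p q \<le> mixed_moment X p' q + \<bar>p - p'\<bar> * E (\<lambda>\<omega>. (X \<omega>)\<^sup>2)"
proof -
  have "mixed_moment X p q \<le>
      E (\<lambda>\<omega>. (p' * (X \<omega>)\<^sup>2 + q * (X \<omega>) ^ 3) + \<bar>p - p'\<bar> * (X \<omega>)\<^sup>2)"
    unfolding mixed_moment_def
  proof (rule E_mono)
    fix \<omega>
    have "(p - p') * (X \<omega>)\<^sup>2 \<le> \<bar>p - p'\<bar> * (X \<omega>)\<^sup>2" by (intro mult_right_mono) auto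
    then show "p * (X \<omega>)\<^sup>2 + q * X \<omega> ^ 3 \<le> p' * (X \<omega>)\<^sup>2 + q * X \<omega> ^ 3 + \<bar>p - p'\<bar> * (X \<omega>)\<^sup>2"
      by (simp add: algebra_simps)
  qed (use assms in \<open>auto intro!: mem_intros\<close>)
  also have "\<dots> \<le> mixed_moment X p' q + E (\<lambda>\<omega>. \<bar>p - p'\<bar> * (X \<omega>)\<^sup>2)"
    unfolding mixed_moment_def by (intro E_subadd mem_intros assms)
  also have "E (\<lambda>\<omega>. \<bar>p - p'\<bar> * (X \<omega>)\<^sup>2) = \<bar>p - p'\<bar> * E (\<lambda>\<omega>. (X \<omega>)\<^sup>2)"
    by (intro E_pos_hom mem_intros assms) auto
  finally show ?thesis .
qed

lemma mixed_moment_Lipschitz: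
  assumes "X \<in> H"
  shows "\<bar>mixed_moment X p q - mixed_moment X p' q\<bar> \<le> E (\<lambda>\<omega>. (X \<omega>)\<^sup>2) * \<bar>p - p'\<bar>"
  using mixed_moment_change_le[OF assms, of p q p'] mixed_moment_change_le[OF assms, of p' q p]
  by (simp add: abs_minus_commute mult.commute abs_le_iff)

text \<open>Iterated expectations have to be compared by monotonicity of the outer one, so the value of
  the inner one must itself be a random variable. As a function of the outer variable it is Lipschitz.\<close>

lemma mixed_moment_mem:
  assumes "X \<in> H" "Z \<in> H"
  shows "(\<lambda>\<omega>. mixed_moment X (r + c * Z \<omega>) q) \<in> H"
  by (rule Lipschitz_comp_mem[where g = "\<lambda>p. mixed_moment X p q"])
    (auto intro!: mem_intros mixed_moment_Lipschitz assms)

text \<open>Stability with \<open>a = b = 1\<close> gives \<open>2 E[X] = sqrt 2 E[X]\<close>, and likewise for \<open>- X\<close>.\<close>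

lemma G_normal_centred:
  assumes "X \<in> H" "G_normal E [X]"
  shows "E X = 0" "E (\<lambda>\<omega>. - X \<omega>) = 0"
proof -
  have scaled: "E (\<lambda>\<omega>. e * X \<omega>) = 0" for e
  proof -
    have Z: "(\<lambda>\<omega>. e * X \<omega>) \<in> H" by (intro mem_intros assms)
    have "(\<lambda>x. e * x ! 0) \<in> C_l_Lip (length [X])" by (intro C_l_Lip_intros) auto
    then have "E (\<lambda>\<omega>. E (\<lambda>\<omega>'. e * (1 * X \<omega> + 1 * X \<omega>'))) = E (\<lambda>\<omega>. e * (sqrt (1\<^sup>2 + 1\<^sup>2) * X \<omega>))"
      using assms(2)[unfolded G_normal_def, rule_format, of 1 1 "\<lambda>x. e * x ! 0"] by simp
    moreover have "E (\<lambda>\<omega>. E (\<lambda>\<omega>'. e * (1 * X \<omega> + 1 * X \<omega>'))) = E (\<lambda>\<omega>. e * X \<omega>) + E (\<lambda>\<omega>. e * X \<omega>)"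
      using E_add_const[OF Z] E_add_const[OF Z, of "E (\<lambda>\<omega>. e * X \<omega>)"]
      by (simp add: distrib_left add.commute)
    moreover have "E (\<lambda>\<omega>. e * (sqrt (1\<^sup>2 + 1\<^sup>2) * X \<omega>)) = sqrt 2 * E (\<lambda>\<omega>. e * X \<omega>)"
      using E_pos_hom[OF Z, of "sqrt 2"] by (simp add: mult_ac)
    ultimately have "(2 - sqrt 2) * E (\<lambda>\<omega>. e * X \<omega>) = 0" by (simp add: algebra_simps)
    moreover have "sqrt 2 \<noteq> 2" using real_sqrt_pow2[of 2] by fastforce
    ultimately show ?thesis by simp
  qed
  show "E X = 0" "E (\<lambda>\<omega>. - X \<omega>) = 0" using scaled[of 1] scaled[of "-1"] by simp_all
qed

lemma E_cubic_centred:
  assumes "X \<in> H" "E X = 0" "E (\<lambda>\<omega>. - X \<omega>) = 0"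
  shows "E (\<lambda>\<omega>. k + r * X \<omega> + p * (X \<omega>)\<^sup>2 + q * (X \<omega>) ^ 3) = k + mixed_moment X p q"
proof -
  have "E (\<lambda>\<omega>. k + (r * X \<omega> + (p * (X \<omega>)\<^sup>2 + q * (X \<omega>) ^ 3))) =
      k + E (\<lambda>\<omega>. r * X \<omega> + (p * (X \<omega>)\<^sup>2 + q * (X \<omega>) ^ 3))"
    by (intro E_add_const mem_intros assms)
  also have "E (\<lambda>\<omega>. r * X \<omega> + (p * (X \<omega>)\<^sup>2 + q * (X \<omega>) ^ 3)) = mixed_moment X p q"
    unfolding mixed_moment_def by (intro E_add_scaled_centred mem_intros assms)
  finally show ?thesis by (simp add: add.assoc)
qed

text \<open>Stability with \<open>a = b = 1 / sqrt 2\<close>, after expanding the powers of the sum. The term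
  \<open>3 x X'\<^sup>2\<close> of the cube makes the inner second-order coefficient depend on \<open>x\<close>; the terms that are
  linear in \<open>X'\<close> have no effect.\<close>

lemma mixed_moment_G_normal:
  assumes "X \<in> H" "G_normal E [X]" and c: "c = 1 / (2 * sqrt 2)"
  shows "mixed_moment X p q =
    E (\<lambda>\<omega>. p / 2 * (X \<omega>)\<^sup>2 + c * q * X \<omega> ^ 3 + mixed_moment X (p / 2 + 3 * c * q * X \<omega>) (c * q))"
proof -
  define u where "u = 1 / sqrt 2"
  have u: "u \<ge> 0" "u\<^sup>2 = 1 / 2" "u ^ 3 = c"
    by (simp_all add: u_def c power_divide power3_eq_cube)
  let ?\<phi> = "\<lambda>x::real list. p * (x ! 0)\<^sup>2 + q * (x ! 0) ^ 3"
  have "?\<phi> \<in> C_l_Lip (length [X])" by (intro C_l_Lip_intros) auto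
  then have "E (\<lambda>\<omega>. E (\<lambda>\<omega>'. p * (u * X \<omega> + u * X \<omega>')\<^sup>2 + q * (u * X \<omega> + u * X \<omega>') ^ 3)) =
      mixed_moment X p q"
    using assms(2)[unfolded G_normal_def, rule_format, of u u ?\<phi>] u by (simp add: mixed_moment_def)
  moreover have "E (\<lambda>\<omega>'. p * (u * x + u * X \<omega>')\<^sup>2 + q * (u * x + u * X \<omega>') ^ 3) =
      p / 2 * x\<^sup>2 + c * q * x ^ 3 + mixed_moment X (p / 2 + 3 * c * q * x) (c * q)" for x
  proof -
    have "p * (u * x + u * y)\<^sup>2 + q * (u * x + u * y) ^ 3 =
        (p * u\<^sup>2 * x\<^sup>2 + u ^ 3 * q * x ^ 3) + (2 * p * u\<^sup>2 * x + 3 * u ^ 3 * q * x\<^sup>2) * y +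
        (p * u\<^sup>2 + 3 * u ^ 3 * q * x) * y\<^sup>2 + (u ^ 3 * q) * y ^ 3" for y
      by (simp add: algebra_simps power2_eq_square power3_eq_cube)
    then show ?thesis
      using E_cubic_centred[OF assms(1) G_normal_centred[OF assms(1,2)]] by (simp add: u)
  qed
  ultimately show ?thesis by simp
qed

lemma E_scaled_square_ge:
  assumes "X \<in> H" "- E (\<lambda>\<omega>. - (X \<omega>)\<^sup>2) \<le> t" "t \<le> E (\<lambda>\<omega>. (X \<omega>)\<^sup>2)"
  shows "p * t \<le> E (\<lambda>\<omega>. p * (X \<omega>)\<^sup>2)"
proof (cases "p \<ge> 0")
  case True
  then have "E (\<lambda>\<omega>. p * (X \<omega>)\<^sup>2) = p * E (\<lambda>\<omega>. (X \<omega>)\<^sup>2)"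
    by (intro E_pos_hom mem_intros assms)
  with True show ?thesis using assms by (simp add: mult_left_mono)
next
  case False
  then have "E (\<lambda>\<omega>. (-p) * (- (X \<omega>)\<^sup>2)) = (-p) * E (\<lambda>\<omega>. - (X \<omega>)\<^sup>2)"
    by (intro E_pos_hom mem_intros assms) auto
  moreover have "(-p) * (-t) \<le> (-p) * E (\<lambda>\<omega>. - (X \<omega>)\<^sup>2)"
    using False assms(2) by (intro mult_left_mono) auto
  ultimately show ?thesis by simp
qed

text \<open>The error term is the possible bias of the third moment. In the induction step, the induction
  hypothesis is applied to the inner expectation, and the resulting term linear in \<open>x\<close> vanishes by
  centring. It is then applied to the outer expectation. Both applications carry the coefficient
  \<open>c q\<close> with \<open>c = 1 / (2 sqrt 2)\<close>, so that the error is multiplied by \<open>2 c = 1 / sqrt 2\<close>.\<close>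

lemma mixed_moment_ge_approx:
  assumes "X \<in> H" "G_normal E [X]"
    and t: "- E (\<lambda>\<omega>. - (X \<omega>)\<^sup>2) \<le> t" "t \<le> E (\<lambda>\<omega>. (X \<omega>)\<^sup>2)"
  shows "p * t - E (\<lambda>\<omega>. \<bar>X \<omega>\<bar> ^ 3) * \<bar>q\<bar> * (1 / sqrt 2) ^ n \<le> mixed_moment X p q"
proof (induction n arbitrary: p q)
  case 0
  have "p * t - \<bar>q\<bar> * E (\<lambda>\<omega>. \<bar>X \<omega>\<bar> ^ 3) \<le> E (\<lambda>\<omega>. p * (X \<omega>)\<^sup>2) - E (\<lambda>\<omega>. \<bar>q\<bar> * \<bar>X \<omega>\<bar> ^ 3)"
    using E_pos_hom[of "\<lambda>\<omega>. \<bar>X \<omega>\<bar> ^ 3" "\<bar>q\<bar>"] E_scaled_square_ge[OF assms(1) t] assms(1)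
    by (simp add: mem_intros)
  also have "\<dots> \<le> E (\<lambda>\<omega>. p * (X \<omega>)\<^sup>2 - \<bar>q\<bar> * \<bar>X \<omega>\<bar> ^ 3)"
    by (intro E_diff_ge mem_intros assms)
  also have "\<dots> \<le> mixed_moment X p q"
    unfolding mixed_moment_def
  proof (rule E_mono)
    fix \<omega>
    have "\<bar>q * X \<omega> ^ 3\<bar> = \<bar>q\<bar> * \<bar>X \<omega>\<bar> ^ 3" by (simp add: abs_mult power_abs)
    then show "p * (X \<omega>)\<^sup>2 - \<bar>q\<bar> * \<bar>X \<omega>\<bar> ^ 3 \<le> p * (X \<omega>)\<^sup>2 + q * X \<omega> ^ 3" by linarith
  qed (intro mem_intros assms)+
  finally show ?case by (simp add: mult.commute)
next
  case (Suc n)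
  define K where "K = E (\<lambda>\<omega>. \<bar>X \<omega>\<bar> ^ 3) * (1 / sqrt 2) ^ n"
  define c :: real where "c = 1 / (2 * sqrt 2)"
  have c: "c > 0" by (simp add: c_def)
  have IH: "p * t - K * \<bar>q\<bar> \<le> mixed_moment X p q" for p q
    using Suc.IH[of p q] by (simp add: K_def mult_ac)
  let ?k = "p / 2 * t - K * \<bar>c * q\<bar>"
  have "p * t - 2 * K * \<bar>c * q\<bar> \<le> ?k + mixed_moment X (p / 2) (c * q)"
    using IH[of "p / 2" "c * q"] by simp
  also have "\<dots> = E (\<lambda>\<omega>. ?k + (3 * c * q * t) * X \<omega> + p / 2 * (X \<omega>)\<^sup>2 + (c * q) * X \<omega> ^ 3)"
    using E_cubic_centred[OF assms(1) G_normal_centred[OF assms(1,2)],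
      of ?k "3 * c * q * t" "p / 2" "c * q"] by (rule sym)
  also have "\<dots> \<le> E (\<lambda>\<omega>. p / 2 * (X \<omega>)\<^sup>2 + c * q * X \<omega> ^ 3 +
      mixed_moment X (p / 2 + 3 * c * q * X \<omega>) (c * q))"
  proof (rule E_mono)
    fix \<omega>
    show "?k + (3 * c * q * t) * X \<omega> + p / 2 * (X \<omega>)\<^sup>2 + (c * q) * X \<omega> ^ 3 \<le>
      p / 2 * (X \<omega>)\<^sup>2 + c * q * X \<omega> ^ 3 + mixed_moment X (p / 2 + 3 * c * q * X \<omega>) (c * q)"
      using IH[of "p / 2 + 3 * c * q * X \<omega>" "c * q"] by (simp add: algebra_simps)
  qed (intro mem_intros mixed_moment_mem assms)+
  also have "\<dots> = mixed_moment X p q"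
    by (rule mixed_moment_G_normal[OF assms(1,2) c_def, symmetric])
  finally have "p * t - 2 * K * \<bar>c * q\<bar> \<le> mixed_moment X p q" .
  moreover have "2 * K * \<bar>c * q\<bar> = E (\<lambda>\<omega>. \<bar>X \<omega>\<bar> ^ 3) * \<bar>q\<bar> * (1 / sqrt 2) ^ Suc n"
    using c by (simp add: K_def abs_mult) (simp add: c_def)
  ultimately show ?case by simp
qed

lemma mixed_moment_ge:
  assumes "X \<in> H" "G_normal E [X]"
    and "- E (\<lambda>\<omega>. - (X \<omega>)\<^sup>2) \<le> t" "t \<le> E (\<lambda>\<omega>. (X \<omega>)\<^sup>2)"
  shows "p * t \<le> mixed_moment X p q"
proof -
  have "(\<lambda>n. (1 / sqrt 2) ^ n) \<longlonglongrightarrow> 0" by (rule LIMSEQ_power_zero) simp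
  then have "(\<lambda>n. p * t - E (\<lambda>\<omega>. \<bar>X \<omega>\<bar> ^ 3) * \<bar>q\<bar> * (1 / sqrt 2) ^ n) \<longlonglongrightarrow>
      p * t - E (\<lambda>\<omega>. \<bar>X \<omega>\<bar> ^ 3) * \<bar>q\<bar> * 0"
    by (intro tendsto_diff tendsto_mult tendsto_const)
  then show ?thesis
    using mixed_moment_ge_approx[OF assms] by (intro LIMSEQ_le_const2) auto
qed

text \<open>For \<open>y = r \<bar>x\<bar>\<close> the inequality \<open>y - y\<^sup>3 \<le> 1\<close> gives \<open>\<bar>x\<bar> \<ge> r x\<^sup>2 - r\<^sup>3 x\<^sup>4\<close>. The quadratic
  part together with the cube has expectation at least \<open>d r E[X\<^sup>2]\<close>, and the quartic part costs only
  \<open>d r\<^sup>3 E[X\<^sup>4]\<close>, which is of higher order in \<open>r\<close>.\<close>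

lemma E_cube_plus_abs_pos:
  assumes "X \<in> H" "G_normal E [X]" "0 < E (\<lambda>\<omega>. (X \<omega>)\<^sup>2)"
    and "- E (\<lambda>\<omega>. - (X \<omega>)\<^sup>2) \<le> E (\<lambda>\<omega>. (X \<omega>)\<^sup>2)" and "d > 0"
  shows "0 < E (\<lambda>\<omega>. X \<omega> ^ 3 + d * \<bar>X \<omega>\<bar>)"
proof -
  define s where "s = E (\<lambda>\<omega>. (X \<omega>)\<^sup>2)"
  define Q where "Q = E (\<lambda>\<omega>. X \<omega> ^ 4)"
  \<comment> \<open>small enough for \<open>r\<^sup>2 Q < s\<close>, the extra 1 guarding against division by zero\<close>
  define r where "r = sqrt (s / (2 * (\<bar>Q\<bar> + 1)))"
  have s: "s > 0" using assms by (simp add: s_def)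
  then have r: "r > 0" "r\<^sup>2 = s / (2 * (\<bar>Q\<bar> + 1))" by (auto simp: r_def)
  have "r\<^sup>2 * Q \<le> r\<^sup>2 * (\<bar>Q\<bar> + 1)" by (intro mult_left_mono) auto
  also have "\<dots> = s / 2" by (simp add: r(2) field_simps)
  also have "\<dots> < s" using s by simp
  finally have "r\<^sup>2 * Q < s" .
  then have "0 < d * r * (s - r\<^sup>2 * Q)" using r assms by simp
  also have "\<dots> = d * r * s - d * r ^ 3 * Q" by (simp add: algebra_simps power2_eq_square power3_eq_cube)
  also have "\<dots> \<le> mixed_moment X (d * r) 1 - E (\<lambda>\<omega>. d * r ^ 3 * X \<omega> ^ 4)"
    using mixed_moment_ge[OF assms(1,2,4) order.refl, of "d * r" 1]
      E_pos_hom[of "\<lambda>\<omega>. X \<omega> ^ 4" "d * r ^ 3"] assms r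
    by (simp add: s_def Q_def mem_intros)
  also have "\<dots> \<le> E (\<lambda>\<omega>. (d * r * (X \<omega>)\<^sup>2 + 1 * X \<omega> ^ 3) - d * r ^ 3 * X \<omega> ^ 4)"
    unfolding mixed_moment_def by (intro E_diff_ge mem_intros assms)
  also have "\<dots> \<le> E (\<lambda>\<omega>. X \<omega> ^ 3 + d * \<bar>X \<omega>\<bar>)"
  proof (rule E_mono)
    fix \<omega>
    define y where "y = r * \<bar>X \<omega>\<bar>"
    have y: "y \<ge> 0" using r by (simp add: y_def)
    have "y - y ^ 3 \<le> 1"
    proof (cases "y \<le> 1")
      case True then show ?thesis using zero_le_power[OF y, of 3] by linarith
    next
      case False then show ?thesis using power_increasing[of 1 3 y] by simp
    qed
    then have "d * \<bar>X \<omega>\<bar> * (y - y ^ 3) \<le> d * \<bar>X \<omega>\<bar> * 1" using assms by (intro mult_left_mono) auto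
    moreover have "d * \<bar>X \<omega>\<bar> * (y - y ^ 3) = d * r * \<bar>X \<omega>\<bar>\<^sup>2 - d * r ^ 3 * \<bar>X \<omega>\<bar> ^ 4"
      by (simp add: y_def algebra_simps power2_eq_square power3_eq_cube power4_eq_xxxx)
    ultimately show "(d * r * (X \<omega>)\<^sup>2 + 1 * X \<omega> ^ 3) - d * r ^ 3 * X \<omega> ^ 4 \<le> X \<omega> ^ 3 + d * \<bar>X \<omega>\<bar>"
      by simp
  qed (intro mem_intros assms)+
  finally show ?thesis .
qed

section \<open>Sum and difference of independent G-normal variables\<close>

lemma ident_dist_centred:
  assumes "ident_dist E [Y] [X]" "E X = 0" "E (\<lambda>\<omega>. - X \<omega>) = 0"
  shows "E Y = 0" "E (\<lambda>\<omega>. - Y \<omega>) = 0"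
proof -
  have "E (\<lambda>\<omega>. c * Y \<omega>) = E (\<lambda>\<omega>. c * X \<omega>)" for c
  proof -
    have "(\<lambda>x. c * x ! 0) \<in> C_l_Lip (length [Y])" by (intro C_l_Lip_intros) auto
    then show ?thesis using assms(1) unfolding ident_dist_def by fastforce
  qed
  from this[of 1] this[of "-1"] show "E Y = 0" "E (\<lambda>\<omega>. - Y \<omega>) = 0" using assms by simp_all
qed

lemma mixed_moment_ident_dist:
  assumes "ident_dist E [Y] [X]"
  shows "mixed_moment Y p q = mixed_moment X p q"
proof -
  have "(\<lambda>x. p * (x ! 0)\<^sup>2 + q * (x ! 0) ^ 3) \<in> C_l_Lip (length [Y])" by (intro C_l_Lip_intros) auto
  then show ?thesis using assms unfolding ident_dist_def mixed_moment_def by fastforce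
qed

text \<open>The values \<open>q = 1\<close> and \<open>q = -1\<close> give \<open>(X - Y)\<^sup>2 (X + Y)\<close> and \<open>(X + Y)\<^sup>2 (X - Y)\<close>.
  The cube of \<open>Y\<close> can be discounted whatever its coefficient, since \<open>mixed_moment_ge\<close> is uniform in
  \<open>q\<close>; the freedom to let the variance of \<open>Y\<close> depend on the sign of \<open>X\<close> is the source of positivity.\<close>

lemma E_cubic_pair_pos:
  assumes mem: "X \<in> H" "Y \<in> H" and normal: "normal_dist E X v w" and vw: "0 < w" "v < w"
    and dist: "ident_dist E [Y] [X]" and indep: "indep_from E [Y] [X]"
  shows "0 < E (\<lambda>\<omega>. ((X \<omega>)\<^sup>2 - (Y \<omega>)\<^sup>2) * (X \<omega> - q * Y \<omega>))"
proof -
  have G: "G_normal E [X]" and w: "E (\<lambda>\<omega>. (X \<omega>)\<^sup>2) = w" and v: "- E (\<lambda>\<omega>. - (X \<omega>)\<^sup>2) = v"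
    using normal by (auto simp: normal_dist_def)
  note cX = G_normal_centred[OF mem(1) G]
  note cY = ident_dist_centred[OF dist cX]
  define d where "d = (w - v) / 2"
  define m where "m = (w + v) / 2"
  \<comment> \<open>the maximum of \<open>- x t\<close> over \<open>t\<close> in \<open>[v, w]\<close>, attained at an end point depending on the sign of \<open>x\<close>\<close>
  have lower: "- m * x + d * \<bar>x\<bar> \<le> mixed_moment X (- x) q" for x
  proof (cases "x \<ge> 0")
    case True
    then have "- m * x + d * \<bar>x\<bar> = (- x) * v" by (simp add: m_def d_def field_simps)
    with mixed_moment_ge[OF mem(1) G, of v "- x" q] v w vw show ?thesis by simp
  next
    case False
    then have "- m * x + d * \<bar>x\<bar> = (- x) * w" by (simp add: m_def d_def field_simps)
    with mixed_moment_ge[OF mem(1) G, of w "- x" q] v w vw show ?thesis by simp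
  qed
  have "0 < E (\<lambda>\<omega>. X \<omega> ^ 3 + d * \<bar>X \<omega>\<bar>)"
    using E_cube_plus_abs_pos[OF mem(1) G, of d] vw v w by (simp add: d_def)
  also have "\<dots> = E (\<lambda>\<omega>. - m * X \<omega> + (X \<omega> ^ 3 + d * \<bar>X \<omega>\<bar>))"
    by (intro E_add_scaled_centred[symmetric] mem_intros mem cX)
  also have "\<dots> \<le> E (\<lambda>\<omega>. X \<omega> ^ 3 + mixed_moment X (0 + (-1) * X \<omega>) q)"
  proof (rule E_mono)
    fix \<omega>
    show "- m * X \<omega> + (X \<omega> ^ 3 + d * \<bar>X \<omega>\<bar>) \<le> X \<omega> ^ 3 + mixed_moment X (0 + (-1) * X \<omega>) q"
      using lower[of "X \<omega>"] by simp
  qed (intro mem_intros mixed_moment_mem mem)+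
  also have "\<dots> = E (\<lambda>\<omega>. E (\<lambda>\<omega>'. ((X \<omega>)\<^sup>2 - (Y \<omega>')\<^sup>2) * (X \<omega> - q * Y \<omega>')))"
  proof -
    have "(x\<^sup>2 - y\<^sup>2) * (x - q * y) = x ^ 3 + (- q * x\<^sup>2) * y + (- x) * y\<^sup>2 + q * y ^ 3" for x y
      by (simp add: algebra_simps power2_eq_square power3_eq_cube)
    then have "E (\<lambda>\<omega>'. (x\<^sup>2 - (Y \<omega>')\<^sup>2) * (x - q * Y \<omega>')) = x ^ 3 + mixed_moment X (- x) q" for x
      by (simp only: E_cubic_centred[OF mem(2) cY] mixed_moment_ident_dist[OF dist])
    then show ?thesis by simp
  qed
  also have "\<dots> = E (\<lambda>\<omega>. ((X \<omega>)\<^sup>2 - (Y \<omega>)\<^sup>2) * (X \<omega> - q * Y \<omega>))"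
  proof -
    let ?\<phi> = "\<lambda>x. ((x ! 0)\<^sup>2 - (x ! 1)\<^sup>2) * (x ! 0 - q * x ! 1)"
    have "?\<phi> \<in> C_l_Lip (length [X] + length [Y])" by (intro C_l_Lip_intros) auto
    from indep[unfolded indep_from_def, rule_format, OF this] show ?thesis by simp
  qed
  finally show ?thesis .
qed

text \<open>For a fixed value of \<open>T\<close>, the factor \<open>T\<^sup>2 \<ge> 0\<close> leaves the inner expectation by positive
  homogeneity; this is why a square is used as the test weight.\<close>

lemma indep_from_E_square_mult:
  assumes "S \<in> H" "indep_from E [S] [T]" "T \<in> H" "E S = 0"
  shows "E (\<lambda>\<omega>. (T \<omega>)\<^sup>2 * S \<omega>) = 0"
proof -
  have "(\<lambda>x. (x ! 0)\<^sup>2 * x ! 1) \<in> C_l_Lip (length [T] + length [S])"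
    by (intro C_l_Lip_intros) auto
  from assms(2)[unfolded indep_from_def, rule_format, OF this]
  show ?thesis using assms by (simp add: E_pos_hom E_const)
qed

end

theorem theorem4p1:
  fixes H :: "('w \<Rightarrow> real) set" and E :: "('w \<Rightarrow> real) \<Rightarrow> real"
    and \<sigma>low \<sigma>up :: real and n :: nat
    and Y :: "nat \<Rightarrow> 'w \<Rightarrow> real" and a b :: "nat \<Rightarrow> real" and U V :: "'w \<Rightarrow> real"
  assumes "sublinear_expectation_space H E"
    and "0 < \<sigma>low\<^sup>2" and "\<sigma>low\<^sup>2 < \<sigma>up\<^sup>2" and "n \<ge> 2"
    and "\<And>i. i \<in> {1..n} \<Longrightarrow> Y i \<in> H"
    and "normal_dist E (Y 1) (\<sigma>low\<^sup>2) (\<sigma>up\<^sup>2)"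
    and "\<And>i. i \<in> {1..n - 1} \<Longrightarrow> ident_dist E [Y (i + 1)] [Y i]"
    and "\<And>i. i \<in> {1..n - 1} \<Longrightarrow> indep_from E [Y (i + 1)] (map Y [1..<i + 1])"
    and "a 1 = 1" and "a 2 = 1" and "b 1 = 1" and "b 2 = -1"
    and "\<And>i. i > 2 \<Longrightarrow> a i = 0 \<and> b i = 0"
    and "U = (\<lambda>\<omega>. \<Sum>i=1..n. a i * Y i \<omega>)"
    and "V = (\<lambda>\<omega>. \<Sum>i=1..n. b i * Y i \<omega>)"
  shows "(\<Sum>i=1..n. a i * b i) = 0 \<and> \<not> indep_from E [U] [V] \<and> \<not> indep_from E [V] [U]"
proof -
  interpret sublinear_expectation_space H E by fact
  have mem: "Y 1 \<in> H" "Y 2 \<in> H" using assms(4,5) by auto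
  have dist: "ident_dist E [Y 2] [Y 1]" using assms(7)[of 1] assms(4) by (simp add: numeral_2_eq_2)
  have indep: "indep_from E [Y 2] [Y 1]" using assms(8)[of 1] assms(4) by (simp add: numeral_2_eq_2)
  have first_two: "(\<Sum>i=1..n. f i) = f 1 + f 2" if "\<And>i. i > 2 \<Longrightarrow> f i = 0" for f :: "nat \<Rightarrow> real"
  proof -
    have "(\<Sum>i=1..n. f i) = (\<Sum>i\<in>{1,2}. f i)"
      using assms(4) that by (intro sum.mono_neutral_right) auto
    then show ?thesis by simp
  qed
  have U: "U = (\<lambda>\<omega>. Y 1 \<omega> + Y 2 \<omega>)"
    unfolding assms(14) using assms(9,10,13) by (subst first_two) auto
  have V: "V = (\<lambda>\<omega>. Y 1 \<omega> - Y 2 \<omega>)"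
    unfolding assms(15) using assms(11-13) by (subst first_two) auto
  have orth: "(\<Sum>i=1..n. a i * b i) = 0"
    using assms(9-13) by (subst first_two) auto
  have G: "G_normal E [Y 1]" using assms(6) by (simp add: normal_dist_def)
  note c1 = G_normal_centred[OF mem(1) G]
  note c2 = ident_dist_centred[OF dist c1]
  have UV_mem: "U \<in> H" "V \<in> H" unfolding U V by (intro mem_intros mem)+
  have UV_centred: "E U = 0" "E V = 0"
    using E_add_scaled_centred[OF mem c2, of 1] E_add_scaled_centred[OF mem c2, of "-1"] c1
    by (simp_all add: U V add.commute)
  have "0 < \<sigma>up\<^sup>2" using assms(2,3) by linarith
  note pos = E_cubic_pair_pos[OF mem assms(6) this assms(3) dist indep]
  have "E (\<lambda>\<omega>. (V \<omega>)\<^sup>2 * U \<omega>) > 0"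
    using pos[of 1] by (simp add: U V power2_eq_square algebra_simps)
  then have "\<not> indep_from E [U] [V]"
    using indep_from_E_square_mult[OF UV_mem(1) _ UV_mem(2) UV_centred(1)] by auto
  moreover have "E (\<lambda>\<omega>. (U \<omega>)\<^sup>2 * V \<omega>) > 0"
    using pos[of "-1"] by (simp add: U V power2_eq_square algebra_simps)
  then have "\<not> indep_from E [V] [U]"
    using indep_from_E_square_mult[OF UV_mem(2) _ UV_mem(1) UV_centred(2)] by auto
  ultimately show ?thesis using orth by blast
qed

end
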